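(* Let $V(x)=\sum_{k=0}^nV_kx^k$ be a polynomial of degree $n$ with coefficients in $M_N(\mathbb{C})$ such that $V''(x)=V'(x)V(x)$. Suppose that the pair $(V_0,V_1)\in M_N(\mathbb{C})^2$ satisfies $$V_1^{i_1}V_0^{i_2}V_1^{i_3}V_0^{i_4}\cdots=0\qquad(\text{alternating product of } n+1 \text{ powers with exponents } i_1,\dots,i_{n+1})$$ for all integers $i_1\ge1$, $i_2,\dots,i_{n+1}\ge0$ such that $i_1+\cdots+i_{n+1}\le n+1$ and $\deg_{1,2}(V_1^{i_1}V_0^{i_2}V_1^{i_3}V_0^{i_4}\cdots)\ge n+2$. Then $V\in\mathbb{A}$. In particular, the operator $L=-\partial_x^2+V'(x)$ is bispectral.
   Context: $N\ge 1$. $\deg_{1,2}$ is the grading on noncommutative monomials in the symbols $V_0,V_1$ with $\deg_{1,2}(V_0)=1$ and $\deg_{1,2}(V_1)=2$ (so the degree of a monomial is the number of letters $V_0$ plus twice the number of letters $V_1$). Let $\psi(x,z)=\left(Iz+\frac12V(x)\right)e^{xz}$. Operators in $z$ act from the right: for $B=\sum_{j=0}^{l}\partial_z^j\cdot b_j(z)$ with matrix-valued functions $b_j$ of $z$, $\psi B=\sum_{j=0}^l(\partial_z^j\psi)\,b_j(z)$. The set $\mathbb{A}$ is $$\mathbb{A}=\{\theta\in M_N(\mathbb{C}[x])\mid \exists\, B=B(z,\partial_z)\text{ such that } (\psi B)(x,z)=\theta(x)\psi(x,z)\}.$$ The operator $L$ (acting from the left in $x$) is bispectral, with eigenfunction $\psi$,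 if $L\psi=\psi F(z)$ for some matrix function $F$ (here $F(z)=-z^2I$) and there are a right-acting operator $B(z,\partial_z)$ and a matrix function $\theta(x)$ with $(\psi B)(x,z)=\theta(x)\psi(x,z)$. *)

theory Defs
  imports "HOL-Analysis.Analysis" "HOL-Computational_Algebra.Polynomial"
begin

(* M_N(C) is complex^'n^'n and M_N(C[x]) is complex poly^'n^'n, with N = CARD('n).
   The product is always **, never the componentwise product * of the type vec. *)

section \<open>Matrix polynomials\<close>

definition mat_coeff :: "complex poly^'n^'n \<Rightarrow> nat \<Rightarrow> complex^'n^'n" where
  "mat_coeff V k = map_matrix (\<lambda>p. coeff p k) V"

definition mat_degree :: "complex poly^'n^'n \<Rightarrow> nat" where
  "mat_degree V = Max (range (\<lambda>(i, j). degree (V $ i $ j)))"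

definition mat_poly :: "complex poly^'n^'n \<Rightarrow> complex \<Rightarrow> complex^'n^'n" where
  "mat_poly V x = map_matrix (\<lambda>p. poly p x) V"

definition mat_pderiv :: "complex poly^'n^'n \<Rightarrow> complex poly^'n^'n" where
  "mat_pderiv V = map_matrix pderiv V"

lemma mat_poly_altdef:
  fixes V :: "complex poly^'n^'n"
  shows "mat_poly V x = (\<Sum>k\<le>mat_degree V. mat (x ^ k) ** mat_coeff V k)"
proof -
  have "poly (V $ i $ j) x = (\<Sum>k\<le>mat_degree V. x ^ k * coeff (V $ i $ j) k)" for i j
  proof -
    have "degree (V $ i $ j) \<le> mat_degree V"
      unfolding mat_degree_def by (rule Max_ge) (auto intro!: image_eqI[of _ _ "(i, j)"])
    then have "poly (\<Sum>k\<le>mat_degree V. monom (coeff (V $ i $ j) k) k) x = poly (V $ i $ j) x"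
      by (simp add: poly_as_sum_of_monoms')
    then show ?thesis
      by (simp add: poly_sum poly_monom mult.commute)
  qed
  moreover have "(mat c ** A) $ i $ j = c * A $ i $ j" for c :: complex and A :: "complex^'n^'n" and i j
    by (simp add: matrix_matrix_mult_def mat_def if_distrib[of "\<lambda>t. t * _"] cong: if_cong)
  ultimately show ?thesis
    by (simp add: vec_eq_iff mat_poly_def mat_coeff_def)
qed


section \<open>Noncommutative monomials in two symbols\<close>

datatype letter = V0 | V1

definition deg12 :: "letter list \<Rightarrow> nat" where
  "deg12 w = count_list w V0 + 2 * count_list w V1"

(* alternating_word a b [e1, e2, e3] is the monomial a^e1 b^e2 a^e3. *)

fun alternating_word :: "letter \<Rightarrow> letter \<Rightarrow> nat list \<Rightarrow> letter list" where
  "alternating_word a b [] = []"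
| "alternating_word a b (e # es) = replicate e a @ alternating_word b a es"

fun word_value :: "complex^'n^'n \<Rightarrow> complex^'n^'n \<Rightarrow> letter list \<Rightarrow> complex^'n^'n" where
  "word_value A0 A1 [] = mat 1"
| "word_value A0 A1 (s # w) = (case s of V0 \<Rightarrow> A0 | V1 \<Rightarrow> A1) ** word_value A0 A1 w"


section \<open>Differential operators and bispectrality\<close>

definition mat_deriv :: "(complex \<Rightarrow> complex^'n^'n) \<Rightarrow> complex \<Rightarrow> complex^'n^'n" where
  "mat_deriv f z = (\<chi> i j. deriv (\<lambda>w. f w $ i $ j) z)"

definition right_op ::
  "nat \<Rightarrow> (nat \<Rightarrow> complex \<Rightarrow> complex^'n^'n) \<Rightarrow> (complex \<Rightarrow> complex^'n^'n) \<Rightarrow> complex \<Rightarrow> complex^'n^'n" where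
  "right_op l b f z = (\<Sum>j\<le>l. (mat_deriv ^^ j) f z ** b j z)"

(* b is a matrix of rational functions, regular wherever q does not vanish. *)
definition rational_matrix :: "complex poly \<Rightarrow> (complex \<Rightarrow> complex^'n^'n) \<Rightarrow> bool" where
  "rational_matrix q b \<longleftrightarrow>
     (\<exists>P. \<forall>z. poly q z \<noteq> 0 \<longrightarrow> b z = mat (1 / poly q z) ** mat_poly P z)"

(* The coefficients of an operator in z may have poles (for V = V_0 + V_1 x one already
   needs the inverse of z + V_0/2), so the eigenvalue equation is required at every z where a common
   denominator q of the coefficients is nonzero. *)
definition right_eigen ::
  "(complex \<Rightarrow> complex \<Rightarrow> complex^'n^'n) \<Rightarrow> (complex \<Rightarrow> complex^'n^'n) \<Rightarrow> bool" where
  "right_eigen \<psi> \<theta> \<longleftrightarrow>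
     (\<exists>l b q. q \<noteq> 0 \<and> (\<forall>j\<le>l. rational_matrix q (b j)) \<and>
        (\<forall>x z. poly q z \<noteq> 0 \<longrightarrow> right_op l b (\<psi> x) z = \<theta> x ** \<psi> x z))"

definition eigen_algebra ::
  "(complex \<Rightarrow> complex \<Rightarrow> complex^'n^'n) \<Rightarrow> (complex poly^'n^'n) set" where
  "eigen_algebra \<psi> = {\<theta>. right_eigen \<psi> (mat_poly \<theta>)}"

definition bispectral ::
  "((complex \<Rightarrow> complex^'n^'n) \<Rightarrow> complex \<Rightarrow> complex^'n^'n) \<Rightarrow>
   (complex \<Rightarrow> complex \<Rightarrow> complex^'n^'n) \<Rightarrow> bool" where
  "bispectral L \<psi> \<longleftrightarrow>
     (\<exists>F. \<forall>x z. L (\<lambda>t. \<psi> t z) x = \<psi> x z ** F z) \<and> (\<exists>\<theta>. right_eigen \<psi> \<theta>)"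

definition schroedinger_op ::
  "complex poly^'n^'n \<Rightarrow> (complex \<Rightarrow> complex^'n^'n) \<Rightarrow> complex \<Rightarrow> complex^'n^'n" where
  "schroedinger_op U f x = - (mat_deriv ^^ 2) f x + mat_poly U x ** f x"

definition wave_fun :: "complex poly^'n^'n \<Rightarrow> complex \<Rightarrow> complex \<Rightarrow> complex^'n^'n" where
  "wave_fun V x z = (mat z + (1 / 2) *\<^sub>R mat_poly V x) ** mat (exp (x * z))"

end

theory Submission
  imports Defs
begin

text \<open>
  Write \<open>\<psi> = U e\<^sup>x\<^sup>z\<close> with \<open>U = z + V / 2\<close>. Since the \<open>j\<close>-th \<open>z\<close>-derivative of \<open>\<psi>\<close> is
  \<open>(x\<^sup>j U + j x\<^sup>j\<^sup>-\<^sup>1) e\<^sup>x\<^sup>z\<close>, an operator with coefficients \<open>b\<^sub>j(z)\<close> acts on \<open>\<psi>\<close> through its symbol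
  \<open>b(x, z) = \<Sum>\<^sub>j x\<^sup>j b\<^sub>j(z)\<close>: it produces \<open>(U b + \<partial>\<^sub>x b) e\<^sup>x\<^sup>z\<close>. So \<open>V\<close> lies in the algebra as soon as
  \<open>\<partial>\<^sub>x b + U b = V U\<close> has a solution that is polynomial in \<open>x\<close> and rational in \<open>z\<close>. The
  substitution \<open>b = V + c\<close> turns this into \<open>(z - S) c = - V'\<close>, where \<open>S X = - (X' + V X / 2)\<close> acts
  on matrix polynomials in \<open>x\<close>. A rational solution \<open>c\<close> exists if some nonzero polynomial \<open>p\<close> has
  \<open>p(S) V' = 0\<close>: the quotient \<open>(p(z) - p(S)) / (z - S)\<close> is a polynomial in \<open>z\<close> and \<open>S\<close>, and
  applied to \<open>V'\<close> and divided by \<open>- p(z)\<close> it gives \<open>c\<close> (lemma \<open>resolvent_numerator\<close>).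

  Such a \<open>p\<close> exists because the orbit \<open>V', S V', S\<^sup>2 V', \<dots>\<close> has bounded degree in \<open>x\<close> and hence
  spans a space of finite dimension (lemma \<open>bounded_sequence_dependent\<close>). The degree bound is where
  the hypothesis on words enters. That hypothesis says that every word in \<open>V\<^sub>0, V\<^sub>1\<close> which starts with
  \<open>V\<^sub>1\<close> and has degree at least \<open>n + 2\<close> vanishes, whatever its length (lemma \<open>V1_word_vanishes\<close>). Let
  \<open>M\<^sub>d\<close> be the span of all \<open>V\<^sub>0\<^sup>a V\<^sub>1 w\<close> with \<open>deg (V\<^sub>1 w) \<ge> d\<close>. Powers of \<open>V\<^sub>0\<close> on the left do not count, so
  \<open>V\<^sub>0 M\<^sub>d \<subseteq> M\<^sub>d\<close>, and \<open>M\<^sub>d M\<^sub>e \<subseteq> M\<^sub>d\<^sub>+\<^sub>e\<close>. The equation \<open>V'' = V' V\<close> puts \<open>V\<^sub>k\<close> into \<open>M\<^sub>k\<^sub>+\<^sub>1\<close> for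
  \<open>k \<ge> 1\<close>. Consequently \<open>S\<close> preserves the matrix polynomials whose coefficient of \<open>x\<^sup>m\<close> lies in
  \<open>M\<^sub>m\<^sub>+\<^sub>2\<close> for every \<open>m\<close>, and \<open>V'\<close> is one of them (lemma \<open>orbit_in_V1_span\<close>). As \<open>M\<^sub>m\<^sub>+\<^sub>2 = 0\<close> for
  \<open>m \<ge> n\<close>, the whole orbit has degree less than \<open>n\<close>.
\<close>

section \<open>Matrices with scalar and polynomial entries\<close>

lemma mat_nth: "mat c $ i $ j = (if i = j then c else 0)"
  by (simp add: mat_def)

lemma mat_mult_nth [simp]:
  fixes A :: "'a::semiring_1^'n^'n"
  shows "(mat c ** A) $ i $ j = c * A $ i $ j"
  by (simp add: matrix_matrix_mult_def mat_def if_distrib[of "\<lambda>t. t * _"] cong: if_cong)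

lemma mult_mat_nth [simp]:
  fixes A :: "'a::comm_semiring_1^'n^'n"
  shows "(A ** mat c) $ i $ j = c * A $ i $ j"
  by (simp add: matrix_matrix_mult_def mat_def if_distrib[of "\<lambda>t. _ * t"] mult.commute cong: if_cong)

lemma mat_mult_left_commute:
  fixes A B :: "'a::comm_semiring_1^'n^'n"
  shows "A ** (mat c ** B) = mat c ** (A ** B)"
  by (simp add: vec_eq_iff matrix_matrix_mult_def[of A] sum_distrib_left mult.left_commute)

lemma matrix_add_mult_distrib:
  fixes A :: "'a::semiring_1^'n^'n"
  shows "(A + B) ** C = A ** C + B ** C"
  by (simp add: vec_eq_iff matrix_matrix_mult_def distrib_right sum.distrib)

lemma zero_matrix_mult [simp]:
  fixes A :: "'a::semiring_1^'n^'n"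
  shows "0 ** A = 0"
  by (simp add: vec_eq_iff matrix_matrix_mult_def)

lemma matrix_mult_zero [simp]:
  fixes A :: "'a::semiring_1^'n^'n"
  shows "A ** 0 = 0"
  by (simp add: vec_eq_iff matrix_matrix_mult_def)

lemma matrix_mult_sum_right:
  fixes A :: "'a::semiring_1^'n^'n"
  shows "A ** (\<Sum>k\<in>K. f k) = (\<Sum>k\<in>K. A ** f k)"
  by (induction K rule: infinite_finite_induct) (simp_all add: matrix_add_ldistrib)

lemma mat_coeff_nth [simp]: "mat_coeff A k $ i $ j = coeff (A $ i $ j) k"
  by (simp add: mat_coeff_def)

lemma mat_poly_nth [simp]: "mat_poly A x $ i $ j = poly (A $ i $ j) x"
  by (simp add: mat_poly_def)

lemma mat_pderiv_nth [simp]: "mat_pderiv A $ i $ j = pderiv (A $ i $ j)"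
  by (simp add: mat_pderiv_def)

lemma scaleR_half: "(1 / 2) *\<^sub>R c = c / 2" for c :: complex
  by (simp add: scaleR_conv_of_real)

lemma mat_coeff_mult: "mat_coeff (A ** B) m = (\<Sum>k\<le>m. mat_coeff A k ** mat_coeff B (m - k))"
proof -
  have "(\<Sum>l\<in>UNIV. \<Sum>k\<le>m. coeff (A $ i $ l) k * coeff (B $ l $ j) (m - k)) =
        (\<Sum>k\<le>m. \<Sum>l\<in>UNIV. coeff (A $ i $ l) k * coeff (B $ l $ j) (m - k))" for i j
    by (rule sum.swap)
  then show ?thesis
    by (simp add: vec_eq_iff matrix_matrix_mult_def coeff_sum coeff_mult)
qed

lemma mat_coeff_pderiv: "mat_coeff (mat_pderiv A) m = mat (of_nat (Suc m)) ** mat_coeff A (Suc m)"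
  by (simp add: vec_eq_iff coeff_pderiv)

lemma mat_poly_mult: "mat_poly (A ** B) x = mat_poly A x ** mat_poly B x"
  by (simp add: vec_eq_iff matrix_matrix_mult_def poly_sum)

lemma
  assumes "\<And>m. m > n \<Longrightarrow> mat_coeff A m = 0"
  shows mat_poly_sum: "mat_poly A x = (\<Sum>m\<le>n. mat (x ^ m) ** mat_coeff A m)"
    and mat_poly_pderiv_sum:
      "mat_poly (mat_pderiv A) x = (\<Sum>m\<le>n. mat (of_nat m * x ^ (m - 1)) ** mat_coeff A m)"
proof -
  have A: "A $ i $ j = (\<Sum>m\<le>n. monom (coeff (A $ i $ j) m) m)" for i j
  proof (intro poly_as_sum_of_monoms'[symmetric] degree_le allI impI)
    fix m assume "n < m"
    then show "coeff (A $ i $ j) m = 0"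
      using assms[of m] by (simp add: vec_eq_iff)
  qed
  have "poly (A $ i $ j) x = (\<Sum>m\<le>n. x ^ m * coeff (A $ i $ j) m)" for i j
    by (subst A) (simp add: poly_sum poly_monom mult.commute)
  then show "mat_poly A x = (\<Sum>m\<le>n. mat (x ^ m) ** mat_coeff A m)"
    by (simp add: vec_eq_iff)
  have "poly (pderiv (A $ i $ j)) x = (\<Sum>m\<le>n. of_nat m * x ^ (m - 1) * coeff (A $ i $ j) m)" for i j
    by (subst A) (simp add: higher_pderiv_sum[where n = 1, simplified] pderiv_monom poly_sum poly_monom mult_ac)
  then show "mat_poly (mat_pderiv A) x = (\<Sum>m\<le>n. mat (of_nat m * x ^ (m - 1)) ** mat_coeff A m)"
    by (simp add: vec_eq_iff)
qed

section \<open>Words that vanish\<close>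

fun other :: "letter \<Rightarrow> letter" where
  "other V0 = V1"
| "other V1 = V0"

lemma other_cases: "t = s \<or> t = other s"
  by (cases s; cases t) auto

lemma other_other [simp]: "other (other s) = s"
  by (cases s) auto

lemma alternating_word_zeros: "alternating_word a b (replicate m 0) = []"
  by (induction m arbitrary: a b) auto

text \<open>
  Each maximal run of equal letters gives one exponent, so there are at most as many exponents as
  letters, and zeros fill up the list to length \<open>m\<close>.
\<close>

lemma word_as_alternating_word:
  assumes "length (s # w) \<le> m"
  shows "\<exists>e es. length (Suc e # es) = m \<and> sum_list (Suc e # es) = length (s # w) \<and>
           alternating_word s (other s) (Suc e # es) = s # w"
  using assms
proof (induction w arbitrary: s m)
  case Nil
  then show ?case
    by (intro exI[of _ 0] exI[of _ "replicate (m - 1) 0"]) (auto simp: alternating_word_zeros sum_list_replicate)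
next
  case (Cons t w)
  from other_cases[of t s] show ?case
  proof
    assume "t = s"
    moreover obtain e es where "length (Suc e # es) = m" "sum_list (Suc e # es) = length (t # w)"
        "alternating_word t (other t) (Suc e # es) = t # w"
      using Cons.IH[of t m] Cons.prems by auto
    ultimately show ?thesis
      by (intro exI[of _ "Suc e"] exI[of _ es]) auto
  next
    assume "t = other s"
    moreover have "length (t # w) \<le> m - 1"
      using Cons.prems by simp
    then obtain e es where "length (Suc e # es) = m - 1" "sum_list (Suc e # es) = length (t # w)"
        "alternating_word t (other t) (Suc e # es) = t # w"
      using Cons.IH by blast
    ultimately show ?thesis
      using Cons.prems by (intro exI[of _ 0] exI[of _ "Suc e # es"]) auto
  qed
qed

lemma deg12_simps [simp]:
  "deg12 [] = 0" "deg12 (V0 # w) = Suc (deg12 w)" "deg12 (V1 # w) = deg12 w + 2"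
  "deg12 (u @ w) = deg12 u + deg12 w"
  by (simp_all add: deg12_def)

lemma length_le_deg12: "length w \<le> deg12 w"
proof (induction w)
  case (Cons s w)
  then show ?case by (cases s) auto
qed simp

lemma word_value_append: "word_value A0 A1 (u @ w) = word_value A0 A1 u ** word_value A0 A1 w"
  by (induction u) (simp_all add: matrix_mul_assoc)

text \<open>
  A word longer than \<open>n + 1\<close> is killed by its prefix of length \<open>n + 1\<close>: as this prefix contains the
  leading \<open>V1\<close>, its degree exceeds its length.
\<close>

lemma V1_word_vanishes:
  assumes "\<And>e :: nat list. length e = n + 1 \<Longrightarrow> e ! 0 \<ge> 1 \<Longrightarrow> sum_list e \<le> n + 1 \<Longrightarrow>
             deg12 (alternating_word V1 V0 e) \<ge> n + 2 \<Longrightarrow>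
             word_value A0 A1 (alternating_word V1 V0 e) = 0"
    and "deg12 (V1 # w) \<ge> n + 2"
  shows "word_value A0 A1 (V1 # w) = 0"
proof -
  have short: "word_value A0 A1 (V1 # u) = 0"
    if u: "length (V1 # u) \<le> n + 1" "deg12 (V1 # u) \<ge> n + 2" for u
  proof -
    obtain e es where "length (Suc e # es) = n + 1" "sum_list (Suc e # es) = length (V1 # u)"
        "alternating_word V1 V0 (Suc e # es) = V1 # u"
      using word_as_alternating_word[OF u(1)] by auto
    then show ?thesis
      using assms(1)[of "Suc e # es"] u by (metis One_nat_def Suc_le_mono le0 nth_Cons_0)
  qed
  show ?thesis
  proof (cases "length (V1 # w) \<le> n + 1")
    case False
    have "deg12 (V1 # take n w) \<ge> n + 2"
      using length_le_deg12[of "take n w"] False by simp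
    then have "word_value A0 A1 (V1 # take n w) = 0"
      by (intro short) auto
    moreover have "V1 # w = (V1 # take n w) @ drop n w"
      by simp
    ultimately show ?thesis
      by (metis word_value_append zero_matrix_mult)
  qed (use short assms(2) in blast)
qed

section \<open>The filtration by degree after the leading powers of \<open>V\<^sub>0\<close>\<close>

text \<open>
  The span of the products \<open>A0\<^sup>a W\<close>, where \<open>W\<close> is the value of a word that starts with \<open>V1\<close> and has
  degree at least \<open>d\<close>. The degree ignores the factor \<open>A0\<^sup>a\<close>, since the conditions that force
  words to vanish concern only what starts at the first \<open>V1\<close>.
\<close>

inductive_set V1_span :: "complex^'n^'n \<Rightarrow> complex^'n^'n \<Rightarrow> nat \<Rightarrow> (complex^'n^'n) set"
  for A0 A1 d where
  word: "d \<le> deg12 (V1 # w) \<Longrightarrow> word_value A0 A1 (V1 # w) \<in> V1_span A0 A1 d"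
| zero: "0 \<in> V1_span A0 A1 d"
| add: "X \<in> V1_span A0 A1 d \<Longrightarrow> Y \<in> V1_span A0 A1 d \<Longrightarrow> X + Y \<in> V1_span A0 A1 d"
| scale: "X \<in> V1_span A0 A1 d \<Longrightarrow> mat c ** X \<in> V1_span A0 A1 d"
| V0_mult: "X \<in> V1_span A0 A1 d \<Longrightarrow> A0 ** X \<in> V1_span A0 A1 d"

lemma V1_span_sum: "(\<And>k. k \<in> K \<Longrightarrow> f k \<in> V1_span A0 A1 d) \<Longrightarrow> sum f K \<in> V1_span A0 A1 d"
  by (induction K rule: infinite_finite_induct) (auto intro: V1_span.intros)

lemma V1_span_mono:
  assumes "X \<in> V1_span A0 A1 d'" "d \<le> d'"
  shows "X \<in> V1_span A0 A1 d"
  using assms by induction (auto intro: V1_span.intros simp del: word_value.simps)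

lemma V1_span_trivial:
  assumes "X \<in> V1_span A0 A1 d" "\<And>w. deg12 (V1 # w) \<ge> d \<Longrightarrow> word_value A0 A1 (V1 # w) = 0"
  shows "X = 0"
  using assms by induction (simp_all del: word_value.simps deg12_simps)

lemma V1_span_mult_V0:
  assumes "X \<in> V1_span A0 A1 d"
  shows "X ** A0 \<in> V1_span A0 A1 (Suc d)"
  using assms
proof induction
  case (word w)
  have "word_value A0 A1 (V1 # w) ** A0 = word_value A0 A1 (V1 # (w @ [V0]))"
    by (simp add: word_value_append matrix_mul_assoc)
  then show ?case
    using V1_span.word[of "Suc d" "w @ [V0]" A0 A1] word by (simp del: word_value.simps)
qed (auto intro: V1_span.intros simp: matrix_add_mult_distrib simp flip: matrix_mul_assoc)

lemma V1_span_word_mult: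
  assumes "X \<in> V1_span A0 A1 d"
  shows "word_value A0 A1 (V1 # v) ** X \<in> V1_span A0 A1 (deg12 (V1 # v) + d)"
  using assms
proof (induction arbitrary: v)
  case (word w)
  then have "deg12 (V1 # v) + d \<le> deg12 (V1 # (v @ V1 # w))"
    by simp
  from V1_span.word[OF this] show ?case
    by (simp add: word_value_append matrix_mul_assoc)
next
  case (scale X c)
  then show ?case
    by (simp add: mat_mult_left_commute V1_span.scale del: word_value.simps)
next
  case (V0_mult X)
  \<comment> \<open>The factor \<open>A0\<close> is absorbed into the word on the left, where it raises the degree.\<close>
  have "word_value A0 A1 (V1 # v) ** (A0 ** X) = word_value A0 A1 (V1 # (v @ [V0])) ** X"
    by (simp add: word_value_append matrix_mul_assoc)
  also have "\<dots> \<in> V1_span A0 A1 (deg12 (V1 # (v @ [V0])) + d)"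
    by (rule V0_mult.IH)
  finally show ?case
    by (rule V1_span_mono) simp
qed (auto intro: V1_span.intros simp: matrix_add_ldistrib simp del: word_value.simps)

lemma V1_span_mult:
  assumes "X \<in> V1_span A0 A1 d" "Y \<in> V1_span A0 A1 e"
  shows "X ** Y \<in> V1_span A0 A1 (d + e)"
  using assms(1)
proof induction
  case (word w)
  then show ?case
    by (intro V1_span_mono[OF V1_span_word_mult[OF assms(2)]]) simp
qed (auto intro: V1_span.intros simp: matrix_add_mult_distrib simp flip: matrix_mul_assoc)

text \<open>
  Comparing coefficients of \<open>x\<^sup>l\<close> in \<open>V'' = V' V\<close> writes \<open>V\<^sub>l\<^sub>+\<^sub>2\<close> as a combination of the products
  \<open>V\<^sub>i\<^sub>+\<^sub>1 V\<^sub>l\<^sub>-\<^sub>i\<close>, whose left factor is never \<open>V\<^sub>0\<close>. The right factor can be \<open>V\<^sub>0\<close>; unlike a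
  \<open>V\<^sub>0\<close> on the left it raises the degree, by the one that is needed.
\<close>

lemma mat_coeff_in_V1_span:
  assumes ode: "mat_pderiv (mat_pderiv V) = mat_pderiv V ** V"
  shows "mat_coeff V (Suc k) \<in> V1_span (mat_coeff V 0) (mat_coeff V 1) (k + 2)"
proof (induction k rule: less_induct)
  case (less k)
  let ?A0 = "mat_coeff V 0" and ?A1 = "mat_coeff V 1"
  show ?case
  proof (cases k)
    case 0
    then show ?thesis
      using V1_span.word[of 2 "[]" ?A0 ?A1] by (simp add: numeral_2_eq_2)
  next
    case (Suc l)
    have "mat (of_nat (Suc l)) ** (mat (of_nat (Suc k)) ** mat_coeff V (Suc k)) =
          mat_coeff (mat_pderiv (mat_pderiv V)) l"
      by (simp add: mat_coeff_pderiv Suc)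
    also have "\<dots> = (\<Sum>i\<le>l. mat (of_nat (Suc i)) ** mat_coeff V (Suc i) ** mat_coeff V (l - i))"
      by (simp only: ode mat_coeff_mult mat_coeff_pderiv)
    also have "\<dots> \<in> V1_span ?A0 ?A1 (k + 2)"
    proof (rule V1_span_sum)
      fix i assume "i \<in> {..l}"
      then have i: "i \<le> l" by simp
      have "mat_coeff V (Suc i) ** mat_coeff V (l - i) \<in> V1_span ?A0 ?A1 (k + 2)"
      proof (cases "l - i")
        case 0
        then show ?thesis
          using V1_span_mult_V0[OF less[of i]] i Suc by auto
      next
        case (Suc j)
        have "mat_coeff V (Suc i) ** mat_coeff V (Suc j) \<in> V1_span ?A0 ?A1 ((i + 2) + (j + 2))"
          using \<open>k = Suc l\<close> Suc i by (intro V1_span_mult less) auto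
        then show ?thesis
          using \<open>k = Suc l\<close> Suc i by (auto elim!: V1_span_mono)
      qed
      then show "mat (of_nat (Suc i)) ** mat_coeff V (Suc i) ** mat_coeff V (l - i) \<in> V1_span ?A0 ?A1 (k + 2)"
        by (simp only: V1_span.scale flip: matrix_mul_assoc)
    qed
    finally have "mat (1 / of_nat (Suc l * Suc k)) ** (mat (of_nat (Suc l)) ** (mat (of_nat (Suc k)) ** mat_coeff V (Suc k)))
        \<in> V1_span ?A0 ?A1 (k + 2)"
      by (rule V1_span.scale)
    also have "mat (1 / of_nat (Suc l * Suc k)) ** (mat (of_nat (Suc l)) ** (mat (of_nat (Suc k)) ** mat_coeff V (Suc k)))
        = mat_coeff V (Suc k)"
    proof -
      have "(1 / of_nat (Suc l * Suc k)) * (of_nat (Suc l) * (of_nat (Suc k) * y)) = y" for y :: complex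
        using of_nat_0_neq[of l, where 'a=complex] of_nat_0_neq[of k, where 'a=complex]
        by (simp only: of_nat_mult) (simp add: divide_simps del: of_nat_Suc)
      then show ?thesis
        by (simp only: vec_eq_iff mat_mult_nth) simp
    qed
    finally show ?thesis .
  qed
qed

section \<open>A bounded orbit and its annihilating polynomial\<close>

text \<open>
  Up to the sign, this is \<open>\<partial>\<^sub>x\<close> conjugated by a fundamental solution of \<open>Y' = - V Y / 2\<close>. The sign
  makes the equation for the symbol a resolvent equation \<open>(z - conj_deriv V) c = - V'\<close>.
\<close>

definition conj_deriv :: "complex poly^'n^'n \<Rightarrow> complex poly^'n^'n \<Rightarrow> complex poly^'n^'n" where
  "conj_deriv V X = - (mat_pderiv X + mat [:1/2:] ** (V ** X))"

lemma mat_coeff_conj_deriv: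
  "mat_coeff (conj_deriv V X) m =
     mat (-1) ** (mat (of_nat (Suc m)) ** mat_coeff X (Suc m)
       + mat (1/2) ** (\<Sum>k\<le>m. mat_coeff V k ** mat_coeff X (m - k)))"
  unfolding mat_coeff_mult[symmetric] mat_coeff_pderiv[symmetric]
  by (simp add: vec_eq_iff conj_deriv_def)

text \<open>
  No part of \<open>conj_deriv V\<close> lets the exponent of \<open>x\<close> grow faster than the degree: differentiation
  lowers the exponent and keeps the degree, multiplication by \<open>V\<^sub>k x\<^sup>k\<close> with \<open>k \<ge> 1\<close> raises the exponent
  by \<open>k\<close> and the degree by \<open>k + 1\<close>, and multiplication by \<open>V\<^sub>0\<close> keeps both.
\<close>

lemma orbit_in_V1_span:
  assumes ode: "mat_pderiv (mat_pderiv V) = mat_pderiv V ** V"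
  shows "mat_coeff ((conj_deriv V ^^ k) (mat_pderiv V)) m
           \<in> V1_span (mat_coeff V 0) (mat_coeff V 1) (m + 2)"
proof (induction k arbitrary: m)
  case 0
  show ?case
    using mat_coeff_in_V1_span[OF ode, of m] by (simp only: mat_coeff_pderiv V1_span.scale funpow_0)
next
  case (Suc k)
  let ?A0 = "mat_coeff V 0" and ?A1 = "mat_coeff V 1"
  let ?X = "(conj_deriv V ^^ k) (mat_pderiv V)"
  have "mat_coeff V i ** mat_coeff ?X (m - i) \<in> V1_span ?A0 ?A1 (m + 2)" if "i \<le> m" for i
  proof (cases i)
    case 0
    then show ?thesis
      using Suc.IH[of m] by (simp add: V1_span.V0_mult)
  next
    case (Suc i')
    have "mat_coeff V i ** mat_coeff ?X (m - i) \<in> V1_span ?A0 ?A1 ((i' + 2) + (m - i + 2))"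
      unfolding Suc by (intro V1_span_mult mat_coeff_in_V1_span[OF ode]) (use Suc.IH Suc in auto)
    then show ?thesis
      using that Suc by (auto elim!: V1_span_mono)
  qed
  then show ?case
    using V1_span_mono[OF Suc.IH[of "Suc m"], of "m + 2"]
    unfolding funpow.simps o_apply mat_coeff_conj_deriv
    by (intro V1_span.scale V1_span.add V1_span_sum) auto
qed

lemma more_unknowns_than_equations:
  fixes f :: "'k \<Rightarrow> 'b \<Rightarrow> 'a::field"
  assumes "finite F" "finite K" "card F < card K"
  shows "\<exists>a. (\<exists>k\<in>K. a k \<noteq> 0) \<and> (\<forall>b\<in>F. (\<Sum>k\<in>K. a k * f k b) = 0)"
  using assms
proof (induction F arbitrary: f K rule: finite_induct)
  case empty
  then obtain k where "k \<in> K" by fastforce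
  then show ?case by (intro exI[of _ "\<lambda>_. 1"]) auto
next
  case (insert b F)
  show ?case
  proof (cases "\<forall>k\<in>K. f k b = 0")
    case True
    obtain a where "\<exists>k\<in>K. a k \<noteq> 0" "\<forall>b\<in>F. (\<Sum>k\<in>K. a k * f k b) = 0"
      using insert.IH[of K f] insert.prems insert.hyps by auto
    then show ?thesis
      using True by (intro exI[of _ a]) auto
  next
    case False
    then obtain p where p: "p \<in> K" "f p b \<noteq> 0" by auto
    \<comment> \<open>Gaussian elimination with pivot \<open>f p b\<close>.\<close>
    define g where "g k c = f k c - f k b / f p b * f p c" for k c
    have "card F < card (K - {p})"
      using insert.prems insert.hyps p by simp
    then obtain a where a: "\<exists>k\<in>K - {p}. a k \<noteq> 0" "\<forall>c\<in>F. (\<Sum>k\<in>K - {p}. a k * g k c) = 0"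
      using insert.IH[of "K - {p}" g] insert.prems by auto
    define a' where "a' = a(p := - (\<Sum>k\<in>K - {p}. a k * (f k b / f p b)))"
    have "(\<Sum>k\<in>K. a' k * f k c) = (\<Sum>k\<in>K - {p}. a k * g k c)" for c
    proof -
      have "(\<Sum>k\<in>K. a' k * f k c) = a' p * f p c + (\<Sum>k\<in>K - {p}. a k * f k c)"
        by (subst sum.remove[OF insert.prems(1) p(1)]) (auto simp: a'_def intro!: sum.cong)
      also have "\<dots> = (\<Sum>k\<in>K - {p}. a k * f k c) - (\<Sum>k\<in>K - {p}. a k * (f k b / f p b) * f p c)"
        by (simp add: a'_def sum_distrib_right)
      also have "\<dots> = (\<Sum>k\<in>K - {p}. a k * g k c)"
        by (simp add: g_def right_diff_distrib mult.assoc flip: sum_subtractf)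
      finally show ?thesis .
    qed
    moreover have "g k b = 0" for k
      using p by (simp add: g_def)
    moreover have "\<exists>k\<in>K. a' k \<noteq> 0"
      using a(1) by (auto simp: a'_def)
    ultimately show ?thesis
      using a(2) by (intro exI[of _ a']) auto
  qed
qed

text \<open>
  Only finitely many scalar coefficients can be nonzero throughout the sequence, so enough of its
  members satisfy a nontrivial linear relation. Recording the relation as a polynomial \<open>p\<close> makes it
  read \<open>p(S) (w 0) = 0\<close> when \<open>w\<close> is the orbit of an operator \<open>S\<close>.
\<close>

lemma bounded_sequence_dependent:
  fixes w :: "nat \<Rightarrow> complex poly^'n^'n"
  assumes "\<And>k m. m \<ge> n \<Longrightarrow> mat_coeff (w k) m = 0"
  shows "\<exists>p :: complex poly. p \<noteq> 0 \<and> (\<Sum>k\<le>degree p. mat [:coeff p k:] ** w k) = 0"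
proof -
  define F :: "(nat \<times> 'n \<times> 'n) set" where "F = {..<n} \<times> UNIV"
  obtain a where a: "\<exists>k\<in>{..card F}. a k \<noteq> 0"
      "\<forall>b\<in>F. (\<Sum>k\<le>card F. a k * (case b of (m, i, j) \<Rightarrow> coeff (w k $ i $ j) m)) = 0"
    using more_unknowns_than_equations[of F "{..card F}" "\<lambda>k (m, i, j). coeff (w k $ i $ j) m"]
    by (auto simp: F_def)
  define p where "p = (\<Sum>k\<le>card F. monom (a k) k)"
  have coeff_p: "coeff p k = (if k \<le> card F then a k else 0)" for k
    by (simp add: p_def coeff_sum)
  have "p \<noteq> 0"
    using a(1) coeff_p by (metis atMost_iff coeff_0)
  moreover have "(\<Sum>k\<le>degree p. mat [:coeff p k:] ** w k) = 0"
  proof -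
    have "degree p \<le> card F"
      by (intro degree_le) (simp add: coeff_p)
    then have "(\<Sum>k\<le>degree p. mat [:coeff p k:] ** w k) = (\<Sum>k\<le>card F. mat [:coeff p k:] ** w k)"
      by (intro sum.mono_neutral_left) (auto simp: coeff_eq_0 vec_eq_iff)
    also have "\<dots> = 0"
    proof -
      have "(\<Sum>k\<le>card F. a k * coeff (w k $ i $ j) m) = 0" for i j m
      proof (cases "m < n")
        case True
        then show ?thesis using a(2) by (auto simp: F_def)
      next
        case False
        then show ?thesis
          using assms[of m] by (auto simp: vec_eq_iff)
      qed
      then show ?thesis
        by (simp add: vec_eq_iff poly_eq_iff coeff_sum coeff_p)
    qed
    finally show ?thesis .
  qed
  ultimately show ?thesis by blast
qed

section \<open>The resolvent on an orbit with an annihilating polynomial\<close>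

lemma conj_deriv_scale: "conj_deriv V (mat [:c:] ** X) = mat [:c:] ** conj_deriv V X"
proof -
  have "mat_pderiv (mat [:c:] ** X) = mat [:c:] ** mat_pderiv X"
    by (simp add: vec_eq_iff pderiv_smult)
  moreover have "mat [:1/2:] ** (V ** (mat [:c:] ** X)) = mat [:c:] ** (mat [:1/2:] ** (V ** X))"
    by (subst mat_mult_left_commute, subst mat_mult_left_commute) simp
  ultimately show ?thesis
    by (simp add: conj_deriv_def vec_eq_iff smult_diff_right)
qed

lemma conj_deriv_add: "conj_deriv V (X + Y) = conj_deriv V X + conj_deriv V Y"
proof -
  have "mat_pderiv (X + Y) = mat_pderiv X + mat_pderiv Y"
    by (simp add: vec_eq_iff pderiv_add)
  then show ?thesis
    by (simp add: conj_deriv_def matrix_add_ldistrib)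
qed

lemma conj_deriv_0 [simp]: "conj_deriv V 0 = 0"
  by (simp add: conj_deriv_def vec_eq_iff)

lemma conj_deriv_sum: "conj_deriv V (\<Sum>k\<in>K. f k) = (\<Sum>k\<in>K. conj_deriv V (f k))"
  by (induction K rule: infinite_finite_induct) (simp_all add: conj_deriv_add)

text \<open>
  By Horner's rule this is \<open>\<Sum>\<^sub>j\<^sub><\<^sub>k z\<^sup>k\<^sup>-\<^sup>1\<^sup>-\<^sup>j w\<^sub>j\<close>. On an orbit \<open>w\<^sub>j = S\<^sup>j w\<^sub>0\<close> it is
  \<open>(z\<^sup>k - S\<^sup>k) / (z - S)\<close> applied to \<open>w\<^sub>0\<close>.
\<close>

primrec geometric_quotient :: "(nat \<Rightarrow> complex poly^'n^'n) \<Rightarrow> complex \<Rightarrow> nat \<Rightarrow> complex poly^'n^'n" where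
  "geometric_quotient w z 0 = 0"
| "geometric_quotient w z (Suc k) = mat [:z:] ** geometric_quotient w z k + w k"

lemma geometric_quotient_resolvent:
  assumes "\<And>k. w (Suc k) = conj_deriv V (w k)"
  shows "mat [:z:] ** geometric_quotient w z k - conj_deriv V (geometric_quotient w z k)
           = mat [:z ^ k:] ** w 0 - w k"
proof (induction k)
  case (Suc k)
  let ?D = "geometric_quotient w z k"
  have "mat [:z:] ** geometric_quotient w z (Suc k) - conj_deriv V (geometric_quotient w z (Suc k))
      = mat [:z:] ** (mat [:z:] ** ?D - conj_deriv V ?D) + mat [:z:] ** w k - w (Suc k)"
    by (simp add: conj_deriv_add conj_deriv_scale assms vec_eq_iff smult_add_right smult_diff_right)
  also have "\<dots> = mat [:z ^ Suc k:] ** w 0 - w (Suc k)"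
    unfolding Suc by (simp add: vec_eq_iff smult_diff_right)
  finally show ?case .
qed (simp add: vec_eq_iff)

lemma geometric_quotient_coeff_poly:
  "\<exists>r. \<forall>z. coeff (geometric_quotient w z k $ i $ j) m = poly r z"
proof (induction k)
  case 0
  show ?case by (intro exI[of _ 0]) simp
next
  case (Suc k)
  then obtain r where "\<forall>z. coeff (geometric_quotient w z k $ i $ j) m = poly r z" by blast
  then show ?case
    by (intro exI[of _ "pCons (coeff (w k $ i $ j) m) r"]) simp
qed

lemma geometric_quotient_coeff_eq_0:
  assumes "\<And>k. mat_coeff (w k) m = 0"
  shows "mat_coeff (geometric_quotient w z k) m = 0"
  using assms by (induction k) (simp_all add: vec_eq_iff)

text \<open>On an orbit of \<open>S\<close> this is \<open>(p(z) - p(S)) / (z - S)\<close> applied to \<open>w\<^sub>0\<close>.\<close>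

definition resolvent_numerator :: "(nat \<Rightarrow> complex poly^'n^'n) \<Rightarrow> complex poly \<Rightarrow> complex \<Rightarrow> complex poly^'n^'n" where
  "resolvent_numerator w p z = (\<Sum>k\<le>degree p. mat [:coeff p k:] ** geometric_quotient w z k)"

lemma resolvent_numerator:
  assumes w: "\<And>k. w (Suc k) = conj_deriv V (w k)"
    and p: "(\<Sum>k\<le>degree p. mat [:coeff p k:] ** w k) = 0"
  shows "mat [:z:] ** resolvent_numerator w p z - conj_deriv V (resolvent_numerator w p z)
           = mat [:poly p z:] ** w 0"
proof -
  have "mat [:z:] ** resolvent_numerator w p z - conj_deriv V (resolvent_numerator w p z)
      = (\<Sum>k\<le>degree p. mat [:coeff p k:] ** (mat [:z:] ** geometric_quotient w z k - conj_deriv V (geometric_quotient w z k)))"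
    unfolding resolvent_numerator_def conj_deriv_sum conj_deriv_scale matrix_mult_sum_right
    by (subst mat_mult_left_commute) (simp add: vec_eq_iff smult_diff_right sum_subtractf mult.commute)
  also have "\<dots> = (\<Sum>k\<le>degree p. mat [:coeff p k * z ^ k:] ** w 0) - (\<Sum>k\<le>degree p. mat [:coeff p k:] ** w k)"
    unfolding geometric_quotient_resolvent[of w V, OF w]
    by (simp add: vec_eq_iff smult_diff_right sum_subtractf)
  also have "\<dots> = mat [:poly p z:] ** w 0"
    unfolding p by (simp add: vec_eq_iff poly_altdef smult_sum)
  finally show ?thesis .
qed

section \<open>Right-acting operators on the wave function\<close>

lemma mat_deriv_wave_fun:
  "(mat_deriv ^^ j) (wave_fun V x) z =
     mat (exp (x * z)) ** (mat (x ^ j) ** (mat z + (1/2) *\<^sub>R mat_poly V x) + mat (of_nat j * x ^ (j - 1)))"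
proof (induction j arbitrary: z)
  case 0
  then show ?case
    by (simp add: wave_fun_def vec_eq_iff)
next
  case (Suc j)
  have "((\<lambda>z. exp (x * z) * (x ^ j * ((if i = k then z else 0) + v) + (if i = k then of_nat j * x ^ (j - 1) else 0)))
      has_field_derivative exp (x * z) * (x ^ Suc j * ((if i = k then z else 0) + v)
         + (if i = k then of_nat (Suc j) * x ^ j else 0))) (at z)" for i k :: 'a and v
    by (cases j) (auto intro!: derivative_eq_intros simp: algebra_simps)
  then have D: "deriv (\<lambda>z. exp (x * z) * (x ^ j * ((if i = k then z else 0) + v) + (if i = k then of_nat j * x ^ (j - 1) else 0))) z
      = exp (x * z) * (x ^ Suc j * ((if i = k then z else 0) + v)
         + (if i = k then of_nat (Suc j) * x ^ j else 0))" for i k :: 'a and v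
    by (rule DERIV_imp_deriv)
  have IH: "(mat_deriv ^^ j) (wave_fun V x) = (\<lambda>z. mat (exp (x * z)) ** (mat (x ^ j) ** (mat z + (1/2) *\<^sub>R mat_poly V x) + mat (of_nat j * x ^ (j - 1))))"
    using Suc by blast
  show ?case
    unfolding funpow.simps o_apply IH
    by (simp add: mat_deriv_def vec_eq_iff mat_nth D del: of_nat_Suc power_Suc One_nat_def)
qed

text \<open>
  The eigenvalue equation divided by \<open>e\<^sup>x\<^sup>z\<close>, with the coefficients of the operator collected into
  their symbol \<open>B\<close>. Here \<open>z B - conj_deriv V B\<close> is \<open>B' + (z + V / 2) B\<close>.
\<close>

lemma right_eigen_wave_funI:
  assumes "q \<noteq> 0" "\<And>j. j \<le> l \<Longrightarrow> rational_matrix q (\<lambda>z. mat_coeff (B z) j)"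
    and deg: "\<And>z m. m > l \<Longrightarrow> mat_coeff (B z) m = 0"
    and ode: "\<And>z. poly q z \<noteq> 0 \<Longrightarrow> mat [:z:] ** B z - conj_deriv V (B z) = \<theta> ** (mat [:z:] + mat [:1/2:] ** V)"
  shows "right_eigen (wave_fun V) (mat_poly \<theta>)"
proof -
  have "right_op l (\<lambda>j z. mat_coeff (B z) j) (wave_fun V x) z = mat_poly \<theta> x ** wave_fun V x z"
    if z: "poly q z \<noteq> 0" for x z
  proof -
    define U where "U = mat z + (1/2) *\<^sub>R mat_poly V x"
    have U: "mat_poly (mat [:z:] + mat [:1/2:] ** V) x = U"
      by (auto simp: U_def vec_eq_iff mat_nth scaleR_half)
    have "right_op l (\<lambda>j z. mat_coeff (B z) j) (wave_fun V x) z =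
        (\<Sum>j\<le>l. mat (exp (x * z)) ** (U ** (mat (x ^ j) ** mat_coeff (B z) j) + mat (of_nat j * x ^ (j - 1)) ** mat_coeff (B z) j))"
      unfolding right_op_def mat_deriv_wave_fun U_def[symmetric] mat_mult_left_commute
      by (simp add: matrix_add_mult_distrib flip: matrix_mul_assoc)
    also have "\<dots> = mat (exp (x * z)) ** (U ** mat_poly (B z) x + mat_poly (mat_pderiv (B z)) x)"
      by (simp only: mat_poly_sum[OF deg] mat_poly_pderiv_sum[OF deg] matrix_mult_sum_right sum.distrib matrix_add_ldistrib)
    also have "U ** mat_poly (B z) x + mat_poly (mat_pderiv (B z)) x =
        mat_poly (mat [:z:] ** B z - conj_deriv V (B z)) x"
    proof -
      have "mat [:z:] ** B z - conj_deriv V (B z) = (mat [:z:] + mat [:1/2:] ** V) ** B z + mat_pderiv (B z)"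
        by (simp add: conj_deriv_def matrix_add_mult_distrib flip: matrix_mul_assoc)
      then show ?thesis
        by (simp only: U[symmetric] mat_poly_mult[symmetric]) (simp add: vec_eq_iff)
    qed
    also have "\<dots> = mat_poly \<theta> x ** U"
      unfolding ode[OF z] mat_poly_mult U ..
    also have "mat (exp (x * z)) ** (mat_poly \<theta> x ** U) = mat_poly \<theta> x ** wave_fun V x z"
    proof -
      have "wave_fun V x z = mat (exp (x * z)) ** U"
        by (simp add: wave_fun_def U_def vec_eq_iff)
      then show ?thesis
        by (simp only: mat_mult_left_commute[of "mat_poly \<theta> x"])
    qed
    finally show ?thesis .
  qed
  then show ?thesis
    unfolding right_eigen_def using assms(1,2)
    by (intro exI[of _ l] exI[of _ "\<lambda>j z. mat_coeff (B z) j"] exI[of _ q]) auto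
qed

lemma rational_matrixI:
  assumes "\<And>i j. \<exists>r. \<forall>z. poly q z \<noteq> 0 \<longrightarrow> b z $ i $ j = poly r z / poly q z"
  shows "rational_matrix q b"
proof -
  obtain r where "\<And>i j z. poly q z \<noteq> 0 \<Longrightarrow> b z $ i $ j = poly (r i j) z / poly q z"
    using assms by metis
  then show ?thesis
    unfolding rational_matrix_def by (intro exI[of _ "\<chi> i j. r i j"]) (simp add: vec_eq_iff)
qed

text \<open>
  In \<open>- \<psi>'' + V' \<psi>\<close> the terms \<open>- z V'\<close> and \<open>V' z\<close> cancel, as do \<open>- V'' / 2\<close> and \<open>V' V / 2\<close>.
\<close>

lemma schroedinger_wave_fun:
  assumes ode: "mat_pderiv (mat_pderiv V) = mat_pderiv V ** V"
  shows "schroedinger_op (mat_pderiv V) (\<lambda>t. wave_fun V t z) x = wave_fun V x z ** mat (- z\<^sup>2)"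
proof -
  have "(mat_deriv ^^ 2) (\<lambda>t. wave_fun V t z) x $ i $ j =
      exp (x * z) * (poly (mat_pderiv (mat_pderiv V) $ i $ j) x / 2 + z * poly (pderiv (V $ i $ j)) x
         + z\<^sup>2 * (mat z $ i $ j + poly (V $ i $ j) x / 2))" for i j
  proof -
    let ?v = "V $ i $ j" and ?m = "mat z $ i $ j"
    have "((\<lambda>t. exp (t * z) * (?m + poly ?v t / 2)) has_field_derivative
        exp (t * z) * (poly (pderiv ?v) t / 2 + z * (?m + poly ?v t / 2))) (at t)" for t
      by (auto intro!: derivative_eq_intros simp: algebra_simps)
    then have 1: "deriv (\<lambda>t. exp (t * z) * (?m + poly ?v t / 2)) =
        (\<lambda>t. exp (t * z) * (poly (pderiv ?v) t / 2 + z * (?m + poly ?v t / 2)))"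
      by (blast intro: DERIV_imp_deriv)
    have "((\<lambda>t. exp (t * z) * (poly (pderiv ?v) t / 2 + z * (?m + poly ?v t / 2))) has_field_derivative
        exp (t * z) * (poly (pderiv (pderiv ?v)) t / 2 + z * poly (pderiv ?v) t + z\<^sup>2 * (?m + poly ?v t / 2))) (at t)" for t
      by (auto intro!: derivative_eq_intros simp: field_simps power2_eq_square)
    then have 2: "deriv (\<lambda>t. exp (t * z) * (poly (pderiv ?v) t / 2 + z * (?m + poly ?v t / 2))) x =
        exp (x * z) * (poly (pderiv (pderiv ?v)) x / 2 + z * poly (pderiv ?v) x + z\<^sup>2 * (?m + poly ?v x / 2))"
      by (blast intro: DERIV_imp_deriv)
    show ?thesis
      using 1 2 by (simp add: numeral_2_eq_2 mat_deriv_def wave_fun_def scaleR_half)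
  qed
  moreover have "(mat_poly (mat_pderiv V) x ** wave_fun V x z) $ i $ j =
      exp (x * z) * (z * poly (pderiv (V $ i $ j)) x + poly (mat_pderiv (mat_pderiv V) $ i $ j) x / 2)" for i j
  proof -
    have "mat_poly (mat_pderiv V) x ** wave_fun V x z =
        mat (exp (x * z)) ** (mat z ** mat_poly (mat_pderiv V) x + mat (1/2) ** mat_poly (mat_pderiv V ** V) x)"
    proof -
      have "wave_fun V x z = mat (exp (x * z)) ** (mat z + mat (1/2) ** mat_poly V x)"
        by (simp add: wave_fun_def vec_eq_iff scaleR_half)
      moreover have "mat_poly (mat_pderiv V) x ** mat z = mat z ** mat_poly (mat_pderiv V) x"
        by (simp add: vec_eq_iff)
      ultimately show ?thesis
        by (simp only: mat_mult_left_commute[of "mat_poly (mat_pderiv V) x"] matrix_add_ldistrib mat_poly_mult)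
    qed
    then show ?thesis
      by (simp only: ode[symmetric]) simp
  qed
  moreover have "(wave_fun V x z ** mat (- z\<^sup>2)) $ i $ j =
      - (exp (x * z) * (z\<^sup>2 * (mat z $ i $ j + poly (V $ i $ j) x / 2)))" for i j
    by (simp add: wave_fun_def scaleR_half)
  ultimately show ?thesis
    unfolding vec_eq_iff by (simp only: schroedinger_op_def vector_add_component vector_uminus_component)
      (simp only: distrib_left, simp)
qed

section \<open>Bispectrality\<close>

theorem theorem6:
  fixes V :: "complex poly^'n^'n" and n :: nat
  assumes "mat_degree V = n"
    and "mat_pderiv (mat_pderiv V) = mat_pderiv V ** V"
    and "\<And>e :: nat list. length e = n + 1 \<Longrightarrow> e ! 0 \<ge> 1 \<Longrightarrow> sum_list e \<le> n + 1 \<Longrightarrow>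
           deg12 (alternating_word V1 V0 e) \<ge> n + 2 \<Longrightarrow>
           word_value (mat_coeff V 0) (mat_coeff V 1) (alternating_word V1 V0 e) = 0"
  shows "V \<in> eigen_algebra (wave_fun V) \<and>
         bispectral (schroedinger_op (mat_pderiv V)) (wave_fun V)"
proof -
  define w where "w k = (conj_deriv V ^^ k) (mat_pderiv V)" for k
  have w0: "w 0 = mat_pderiv V" and wS: "w (Suc k) = conj_deriv V (w k)" for k
    by (simp_all add: w_def)
  have span0: "X = 0" if "X \<in> V1_span (mat_coeff V 0) (mat_coeff V 1) d" "d \<ge> n + 2" for X d
    by (rule V1_span_trivial[OF that(1)], rule V1_word_vanishes[OF assms(3)]) (use that(2) in auto)
  have w_coeff: "mat_coeff (w k) m = 0" if "m \<ge> n" for k m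
    using span0[OF orbit_in_V1_span[OF assms(2)]] that by (simp add: w_def)
  obtain p where p: "p \<noteq> 0" "(\<Sum>k\<le>degree p. mat [:coeff p k:] ** w k) = 0"
    using bounded_sequence_dependent[of n w, OF w_coeff] by blast
  \<comment> \<open>The symbol of the operator is \<open>B = V + c\<close> with \<open>(z - S) c = - V'\<close>.\<close>
  define C where "C = resolvent_numerator w p"
  define B where "B z = V + mat [:- (1 / poly p z):] ** C z" for z
  have C: "mat [:z:] ** C z - conj_deriv V (C z) = mat [:poly p z:] ** mat_pderiv V" for z
    unfolding C_def w0[symmetric] by (rule resolvent_numerator[OF wS p(2)])
  have "right_eigen (wave_fun V) (mat_poly V)"
  proof (rule right_eigen_wave_funI[where B = B and l = n and q = p])
    show "rational_matrix p (\<lambda>z. mat_coeff (B z) j)" for j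
    proof (rule rational_matrixI)
      fix i m
      obtain r where r: "\<And>k z. coeff (geometric_quotient w z k $ i $ m) j = poly (r k) z"
        using geometric_quotient_coeff_poly[of w _ i m j] by metis
      have "coeff (C z $ i $ m) j = poly (\<Sum>k\<le>degree p. smult (coeff p k) (r k)) z" for z
        by (simp add: C_def resolvent_numerator_def coeff_sum poly_sum r)
      then show "\<exists>r. \<forall>z. poly p z \<noteq> 0 \<longrightarrow> mat_coeff (B z) j $ i $ m = poly r z / poly p z"
        by (intro exI[of _ "smult (coeff (V $ i $ m) j) p - (\<Sum>k\<le>degree p. smult (coeff p k) (r k))"])
           (simp add: B_def field_simps)
    qed
    show "mat_coeff (B z) m = 0" if "m > n" for z m
    proof -
      have "mat_coeff V m = 0"
      proof (cases m)
        case (Suc k)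
        then show ?thesis
          using span0[OF mat_coeff_in_V1_span[OF assms(2)], of k] that by simp
      qed (use that in simp)
      moreover have "mat_coeff (geometric_quotient w z k) m = 0" for k
        using w_coeff that by (intro geometric_quotient_coeff_eq_0) auto
      ultimately show ?thesis
        by (simp add: vec_eq_iff B_def C_def resolvent_numerator_def coeff_sum)
    qed
    show "mat [:z:] ** B z - conj_deriv V (B z) = V ** (mat [:z:] + mat [:1/2:] ** V)"
      if "poly p z \<noteq> 0" for z
    proof -
      have "mat [:z:] ** B z - conj_deriv V (B z) =
          mat [:z:] ** V - conj_deriv V V + mat [:- (1 / poly p z):] ** (mat [:z:] ** C z - conj_deriv V (C z))"
        by (simp add: B_def conj_deriv_add conj_deriv_scale vec_eq_iff smult_add_right smult_diff_right mult.commute)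
      also have "\<dots> = mat [:z:] ** V - conj_deriv V V - mat_pderiv V"
        unfolding C using that by (simp add: vec_eq_iff)
      also have "\<dots> = V ** (mat [:z:] + mat [:1/2:] ** V)"
        by (simp only: conj_deriv_def matrix_add_ldistrib mat_mult_left_commute[of V]) (simp add: vec_eq_iff)
      finally show ?thesis .
    qed
  qed (use p in auto)
  moreover have "\<exists>F. \<forall>x z. schroedinger_op (mat_pderiv V) (\<lambda>t. wave_fun V t z) x = wave_fun V x z ** F z"
    by (rule exI[of _ "\<lambda>z. mat (- z\<^sup>2)"]) (simp only: schroedinger_wave_fun[OF assms(2)] simp_thms)
  ultimately show ?thesis
    unfolding eigen_algebra_def bispectral_def by auto
qed

end
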